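(* Let $p\in(1,\infty)$. Then $W^{1,p}\cap\Lambda_1\subsetneqq\overline{W^{1,p}\cap\Lambda_1}^{\Lambda_1}\subsetneqq\Lambda_1$, where the closure is taken in the norm of $\Lambda_1$.
   Context: $\Lambda_1$: bounded continuous $f$ on $\mathbb R^n$ with $\|f\|_{\Lambda_1}:=\|f\|_{L^\infty}+\sup_{x\in\mathbb R^n,y\in(0,1]}\sup_{|h|=y}|f(x+h)-2f(x)+f(x-h)|/y<\infty$. $W^{1,p}$ is the usual Sobolev space on $\mathbb R^n$. *)

theory Defs
  imports "HOL-Analysis.Analysis"
begin

coinductive smooth :: "('a::euclidean_space \<Rightarrow> real) \<Rightarrow> bool" where
  "(\<forall>x. f differentiable (at x)) \<Longrightarrow>
   (\<forall>i\<in>Basis. smooth (\<lambda>x. frechet_derivative f (at x) i)) \<Longrightarrow> smooth f"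

definition test_fun :: "('a::euclidean_space \<Rightarrow> real) \<Rightarrow> bool" where
  "test_fun \<phi> \<longleftrightarrow> smooth \<phi> \<and> compact (closure {x. \<phi> x \<noteq> 0})"

definition Lp :: "real \<Rightarrow> ('a::euclidean_space \<Rightarrow> real) set" where
  "Lp p = {f. f \<in> borel_measurable lebesgue \<and> integrable lebesgue (\<lambda>x. \<bar>f x\<bar> powr p)}"

definition W1p :: "real \<Rightarrow> ('a::euclidean_space \<Rightarrow> real) set" where
  "W1p p = {f. f \<in> Lp p \<and>
     (\<forall>i\<in>Basis. \<exists>g \<in> Lp p. \<forall>\<phi>. test_fun \<phi> \<longrightarrow>
        integral\<^sup>L lebesgue (\<lambda>x. f x * frechet_derivative \<phi> (at x) i)
        = - integral\<^sup>L lebesgue (\<lambda>x. g x * \<phi> x))}"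

definition Lambda1 :: "('a::euclidean_space \<Rightarrow> real) set" where
  "Lambda1 = {f. continuous_on UNIV f \<and> bounded (range f) \<and>
     bounded {\<bar>f (x + h) - 2 * f x + f (x - h)\<bar> / norm h | x h. 0 < norm h \<and> norm h \<le> 1}}"

definition Lambda1_norm :: "('a::euclidean_space \<Rightarrow> real) \<Rightarrow> real" where
  "Lambda1_norm f = (SUP x. \<bar>f x\<bar>) +
     (SUP xh \<in> {(x, h). 0 < norm h \<and> norm h \<le> 1}.
        \<bar>f (fst xh + snd xh) - 2 * f (fst xh) + f (fst xh - snd xh)\<bar> / norm (snd xh))"

definition Lambda1_closure :: "('a::euclidean_space \<Rightarrow> real) set \<Rightarrow> ('a \<Rightarrow> real) set" where
  "Lambda1_closure A = {g \<in> Lambda1. \<forall>e>0. \<exists>f\<in>A. Lambda1_norm (\<lambda>x. f x - g x) < e}"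

end

theory Submission
  imports Defs "HOL-Real_Asymp.Real_Asymp"
begin

text \<open>
  A bounded Lipschitz function lies in \<open>\<Lambda>\<^sub>1\<close>, with norm controlled by its sup norm and its Lipschitz
  constant. Let \<open>u = 1 + ln (1 + |x|\<^sup>2)\<close>, which is 1-Lipschitz and tends to infinity. The function
  \<open>1/u\<close> decays too slowly to be in any \<open>L\<^sup>p\<close>. Its truncation \<open>(max 0 (1 - e u))\<^sup>2 / u\<close> is \<open>C\<^sup>1\<close> with
  compact support, hence in \<open>W\<^sup>1\<^sup>,\<^sup>p\<close>, and differs from \<open>1/u\<close> by an \<open>e\<^sup>2\<close>-Lipschitz function bounded
  by \<open>2 e\<close>; so \<open>1/u\<close> is in the closure. The constant 1 is not in the closure, because a function
  uniformly close to it is bounded away from 0 and hence not in \<open>L\<^sup>p\<close>.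
\<close>

section \<open>Elementary facts about \<open>Lambda1\<close>, its norm and its closure
  operator\<close>

lemma lipschitz_bounded_Lambda1:
  fixes f :: "'a::euclidean_space \<Rightarrow> real"
  assumes bd: "\<And>x. \<bar>f x\<bar> \<le> M" and lip: "L-lipschitz_on UNIV f"
  shows "f \<in> Lambda1" and "Lambda1_norm f \<le> M + 2 * L"
proof -
  have quot: "\<bar>f (x + h) - 2 * f x + f (x - h)\<bar> / norm h \<le> 2 * L" if "0 < norm h" for x h
  proof -
    have "\<bar>f (x + h) - f x\<bar> \<le> L * norm h" "\<bar>f (x - h) - f x\<bar> \<le> L * norm h"
      using lipschitz_onD[OF lip, of "x + h" x] lipschitz_onD[OF lip, of "x - h" x]
      by (simp_all add: dist_norm)
    then have "\<bar>f (x + h) - 2 * f x + f (x - h)\<bar> \<le> 2 * L * norm h"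
      by linarith
    then show ?thesis
      using that by (simp add: field_simps)
  qed
  have "continuous_on UNIV f"
    by (rule lipschitz_on_continuous_on[OF lip])
  moreover have "bounded (range f)"
    using bd by (auto simp: bounded_iff)
  moreover have "bounded {\<bar>f (x + h) - 2 * f x + f (x - h)\<bar> / norm h | x h. 0 < norm h \<and> norm h \<le> 1}"
    using quot by (auto simp: bounded_iff intro!: exI[of _ "2 * L"])
  ultimately show "f \<in> Lambda1"
    by (simp add: Lambda1_def)
  \<comment> \<open>A basis vector is an admissible increment, so the supremum in the norm runs over
    a nonempty set and a pointwise bound passes to it.\<close>
  obtain b :: 'a where b: "b \<in> Basis"
    using nonempty_Basis by blast
  then have "(0, b) \<in> {(x::'a, h::'a). 0 < norm h \<and> norm h \<le> 1}"
    by (simp add: nonzero_Basis)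
  then have ne: "{(x::'a, h::'a). 0 < norm h \<and> norm h \<le> 1} \<noteq> {}"
    by blast
  show "Lambda1_norm f \<le> M + 2 * L"
    unfolding Lambda1_norm_def using bd quot
    by (intro add_mono cSUP_least ne) auto
qed

text \<open>The second supremum in the norm is nonnegative, because each quotient is. Membership in
  \<open>Lambda1\<close> makes both suprema genuine upper bounds. This turns closeness in norm into
  uniform closeness.\<close>

lemma abs_le_Lambda1_norm:
  fixes f :: "'a::euclidean_space \<Rightarrow> real"
  assumes "f \<in> Lambda1"
  shows "\<bar>f x\<bar> \<le> Lambda1_norm f"
proof -
  let ?S = "{(x::'a, h::'a). 0 < norm h \<and> norm h \<le> 1}"
  let ?q = "\<lambda>xh. \<bar>f (fst xh + snd xh) - 2 * f (fst xh) + f (fst xh - snd xh)\<bar> / norm (snd xh)"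
  have "bounded {\<bar>f (x + h) - 2 * f x + f (x - h)\<bar> / norm h | x h. 0 < norm h \<and> norm h \<le> 1}"
    using assms by (simp add: Lambda1_def)
  also have "{\<bar>f (x + h) - 2 * f x + f (x - h)\<bar> / norm h | x h. 0 < norm h \<and> norm h \<le> 1} = ?q ` ?S"
    by (auto simp: image_iff; blast)
  finally have bdq: "bdd_above (?q ` ?S)"
    by (rule bounded_imp_bdd_above)
  obtain b :: 'a where b: "b \<in> Basis"
    using nonempty_Basis by blast
  then have "0 \<le> ?q (0, b)" "(0, b) \<in> ?S"
    by (simp_all add: nonzero_Basis)
  then have "0 \<le> (SUP xh\<in>?S. ?q xh)"
    using cSUP_upper2[OF bdq] by blast
  moreover have "bounded (range f)"
    using assms by (simp add: Lambda1_def)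
  then have "bdd_above (range (\<lambda>x. \<bar>f x\<bar>))"
    unfolding bounded_iff bdd_above_def by auto
  then have "\<bar>f x\<bar> \<le> (SUP x. \<bar>f x\<bar>)"
    by (rule cSUP_upper[OF UNIV_I])
  ultimately show ?thesis
    by (simp add: Lambda1_norm_def)
qed

lemma subset_Lambda1_closure:
  assumes "A \<subseteq> Lambda1"
  shows "A \<subseteq> (Lambda1_closure A :: ('a::euclidean_space \<Rightarrow> real) set)"
proof
  fix g assume g: "g \<in> A"
  have "Lambda1_norm (\<lambda>x::'a. 0) \<le> 0"
    using lipschitz_bounded_Lambda1(2)[of "\<lambda>x::'a. 0" 0 0] by (simp add: lipschitz_on_def)
  then have "\<exists>f\<in>A. Lambda1_norm (\<lambda>x. f x - g x) < e" if "e > 0" for e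
    using g that by (intro bexI[of _ g]) simp_all
  then show "g \<in> Lambda1_closure A"
    using g assms by (auto simp: Lambda1_closure_def)
qed

text \<open>Second differences are linear in the function, so the bounds on the quotients add.
  Besides differences, this also yields sums, written as \<open>f - (0 - g)\<close>.\<close>

lemma diff_Lambda1:
  fixes f g :: "'a::euclidean_space \<Rightarrow> real"
  assumes "f \<in> Lambda1" "g \<in> Lambda1"
  shows "(\<lambda>x. f x - g x) \<in> Lambda1"
proof -
  let ?q = "\<lambda>(f :: 'a \<Rightarrow> real) x h. \<bar>f (x + h) - 2 * f x + f (x - h)\<bar> / norm h"
  obtain A where A: "\<And>x h. 0 < norm h \<Longrightarrow> norm h \<le> 1 \<Longrightarrow> ?q f x h \<le> A"
    using assms(1) unfolding Lambda1_def bounded_iff by fastforce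
  obtain B where B: "\<And>x h. 0 < norm h \<Longrightarrow> norm h \<le> 1 \<Longrightarrow> ?q g x h \<le> B"
    using assms(2) unfolding Lambda1_def bounded_iff by fastforce
  have "?q (\<lambda>x. f x - g x) x h \<le> A + B" if "0 < norm h" "norm h \<le> 1" for x h
  proof -
    have "?q (\<lambda>x. f x - g x) x h \<le> ?q f x h + ?q g x h"
      unfolding add_divide_distrib[symmetric] by (rule divide_right_mono) auto
    then show ?thesis
      using A[OF that, of x] B[OF that, of x] by linarith
  qed
  then have "bounded {?q (\<lambda>x. f x - g x) x h | x h. 0 < norm h \<and> norm h \<le> 1}"
    by (auto simp: bounded_iff intro!: exI[of _ "A + B"])
  moreover have "continuous_on UNIV (\<lambda>x. f x - g x)"
    using assms by (auto simp: Lambda1_def intro!: continuous_intros)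
  moreover have "bounded (range (\<lambda>x. f x - g x))"
    using assms by (auto simp: Lambda1_def intro!: bounded_minus_comp)
  ultimately show ?thesis
    by (simp add: Lambda1_def)
qed

section \<open>Functions of bounded support and integration by parts\<close>

lemma integrable_continuous_bounded_support:
  fixes f :: "'a::euclidean_space \<Rightarrow> real"
  assumes cont: "continuous_on UNIV f" and supp: "\<And>x. x \<notin> cball 0 R \<Longrightarrow> f x = 0"
  shows "integrable lborel f" and "integrable lebesgue f"
proof -
  have "set_integrable lborel (cball 0 R) f"
    unfolding set_integrable_def
    by (rule borel_integrable_compact) (auto intro: continuous_on_subset[OF cont])
  moreover have "(\<lambda>x. indicator (cball 0 R) x *\<^sub>R f x) = f"
    using supp by (intro ext) (auto simp: indicator_def)
  ultimately show "integrable lborel f"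
    by (simp add: set_integrable_def)
  then show "integrable lebesgue f"
    by (simp add: integrable_completion borel_measurable_continuous_onI[OF cont])
qed

lemma Lp_continuous_bounded_support:
  fixes f :: "'a::euclidean_space \<Rightarrow> real"
  assumes cont: "continuous_on UNIV f" and supp: "\<And>x. x \<notin> cball 0 R \<Longrightarrow> f x = 0" and p: "0 < p"
  shows "f \<in> Lp p"
proof -
  have "continuous_on UNIV (\<lambda>x. \<bar>f x\<bar> powr p)"
    using p by (intro continuous_on_powr' continuous_intros cont) auto
  then have "integrable lebesgue (\<lambda>x. \<bar>f x\<bar> powr p)"
    by (rule integrable_continuous_bounded_support(2)[where R=R]) (simp add: supp)
  moreover have "f \<in> borel_measurable lebesgue"
    by (intro measurable_completion) (simp add: borel_measurable_continuous_onI[OF cont])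
  ultimately show ?thesis
    by (simp add: Lp_def)
qed

lemma has_derivative_zero_outside_support:
  fixes F :: "'a::euclidean_space \<Rightarrow> real"
  assumes "(F has_derivative F') (at x)" and "\<And>y. y \<notin> cball 0 R \<Longrightarrow> F y = 0" and "x \<notin> cball 0 R"
  shows "F' h = 0"
proof -
  have "((\<lambda>y. 0) has_derivative F') (at x)"
    by (rule has_derivative_transform_within_open[OF assms(1), of "- cball 0 R"])
       (use assms in \<open>auto simp: open_Compl\<close>)
  then have "F' = (\<lambda>h. 0)"
    using has_derivative_unique has_derivative_const by blast
  then show ?thesis by simp
qed

text \<open>Translation invariance makes the integral of every difference quotient vanish, and the
  difference quotients converge dominatedly to the directional derivative.\<close>

lemma integral_directional_derivative_zero:
  fixes F :: "'a::euclidean_space \<Rightarrow> real"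
  assumes der: "\<And>x. (F has_derivative F' x) (at x)"
    and cont: "continuous_on UNIV (\<lambda>x. F' x i)"
    and supp: "\<And>x. x \<notin> cball 0 R \<Longrightarrow> F x = 0"
  shows "integral\<^sup>L lebesgue (\<lambda>x. F' x i) = 0"
proof -
  have contF: "continuous_on UNIV F"
    using der has_derivative_continuous_on[of UNIV F F'] by simp
  have supp': "F' x i = 0" if "x \<notin> cball 0 R" for x
    by (rule has_derivative_zero_outside_support[OF der supp that])
  have "bounded ((\<lambda>x. F' x i) ` cball 0 R)"
    by (intro compact_imp_bounded compact_continuous_image continuous_on_subset[OF cont]) auto
  then obtain B where B: "\<And>x. x \<in> cball 0 R \<Longrightarrow> \<bar>F' x i\<bar> \<le> B"
    unfolding bounded_iff by fastforce
  \<comment> \<open>The derivative vanishes off the ball, so taking the maximum with 0 gives a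
    global bound, also when \<open>R\<close> is negative and the ball is empty.\<close>
  define C where "C = max B 0"
  have C: "\<bar>F' x i\<bar> \<le> C" for x
    using B[of x] supp'[of x] by (cases "x \<in> cball 0 R") (auto simp: C_def)
  define q where "q k x = (F (x + (1 / real (Suc k)) *\<^sub>R i) - F x) * real (Suc k)" for k x
  \<comment> \<open>The difference quotients shift by at most \<open>norm i\<close>, so all of them
    vanish outside this common larger ball; the dominating function is \<open>C\<close> on
    it.\<close>
  define S where "S = R + norm i"
  have line: "((\<lambda>t. F (x + t *\<^sub>R i)) has_real_derivative F' (x + t *\<^sub>R i) i) (at t)" for x t
  proof -
    have "((\<lambda>t. F (x + t *\<^sub>R i)) has_derivative (\<lambda>s. F' (x + t *\<^sub>R i) (s *\<^sub>R i))) (at t)"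
      by (rule has_derivative_compose[OF _ der]) (auto intro!: derivative_eq_intros)
    moreover have "F' (x + t *\<^sub>R i) (s *\<^sub>R i) = F' (x + t *\<^sub>R i) i * s" for s
      using linear_scale[OF has_derivative_linear[OF der]] by simp
    ultimately show ?thesis
      by (simp add: has_field_derivative_def)
  qed
  have qlim: "(\<lambda>k. q k x) \<longlonglongrightarrow> F' x i" for x
  proof -
    have "((\<lambda>t. (F (x + t *\<^sub>R i) - F x) / t) \<longlongrightarrow> F' x i) (at 0)"
      using line[of x 0] by (simp add: has_field_derivative_iff)
    moreover have "filterlim (\<lambda>k. 1 / real (Suc k)) (at 0) sequentially"
      by real_asymp
    ultimately have "(\<lambda>k. (F (x + (1 / real (Suc k)) *\<^sub>R i) - F x) / (1 / real (Suc k))) \<longlonglongrightarrow> F' x i"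
      by (rule filterlim_compose)
    then show ?thesis by (simp add: q_def)
  qed
  have qbd: "\<bar>q k x\<bar> \<le> C * indicator (cball 0 S) x" for k x
  proof (cases "x \<in> cball 0 S")
    case True
    \<comment> \<open>The mean value theorem along the segment makes the quotient a value of the
      directional derivative, hence bounded by \<open>C\<close> uniformly in
      \<open>k\<close>.\<close>
    obtain z where "F (x + (1 / real (Suc k)) *\<^sub>R i) - F (x + 0 *\<^sub>R i)
        = (1 / real (Suc k) - 0) * F' (x + z *\<^sub>R i) i"
      using MVT2[of 0 "1 / real (Suc k)" "\<lambda>t. F (x + t *\<^sub>R i)" "\<lambda>t. F' (x + t *\<^sub>R i) i"] line
      by auto
    then have "q k x = F' (x + z *\<^sub>R i) i"
      by (simp add: q_def)
    then show ?thesis using C True by simp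
  next
    case False
    have "norm x \<le> norm (x + (1 / real (Suc k)) *\<^sub>R i) + norm ((1 / real (Suc k)) *\<^sub>R i)"
      by (metis add_diff_cancel norm_triangle_ineq4)
    moreover have "norm ((1 / real (Suc k)) *\<^sub>R i) \<le> norm i"
      by (simp add: divide_le_eq mult_left_le algebra_simps)
    ultimately have "R < norm (x + (1 / real (Suc k)) *\<^sub>R i)"
      using False by (simp add: S_def)
    moreover have "R < norm x"
      using False norm_ge_zero[of i] unfolding S_def by (simp del: norm_ge_zero)
    ultimately show ?thesis
      using False by (simp add: q_def supp)
  qed
  have intF: "integrable lborel F"
    by (rule integrable_continuous_bounded_support[OF contF supp])
  have q0: "integral\<^sup>L lborel (q k) = 0" for k
  proof -
    let ?c = "(1 / real (Suc k)) *\<^sub>R i"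
    have "integrable (distr lborel borel ((+) ?c)) F"
      using intF by (simp add: lborel_distr_plus)
    then have tr: "integrable lborel (\<lambda>x. F (?c + x))"
      by (subst (asm) integrable_distr_eq) (auto intro: borel_measurable_continuous_onI[OF contF])
    have "integral\<^sup>L lborel F = integral\<^sup>L (distr lborel borel ((+) ?c)) F"
      by (simp add: lborel_distr_plus)
    also have "\<dots> = integral\<^sup>L lborel (\<lambda>x. F (?c + x))"
      by (rule integral_distr) (auto intro: borel_measurable_continuous_onI[OF contF])
    finally have "integral\<^sup>L lborel (\<lambda>x. F (?c + x) - F x) = 0"
      using tr intF by simp
    moreover have "q k = (\<lambda>x. (F (?c + x) - F x) * real (Suc k))"
      by (auto simp: q_def add.commute)
    ultimately show ?thesis by simp
  qed
  have qmeas: "q k \<in> borel_measurable lborel" for k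
    unfolding q_def
    by (simp, intro borel_measurable_continuous_onI continuous_intros continuous_on_compose2[OF contF]) auto
  have "(\<lambda>k. integral\<^sup>L lborel (q k)) \<longlonglongrightarrow> integral\<^sup>L lborel (\<lambda>x. F' x i)"
  proof (rule integral_dominated_convergence[where w="\<lambda>x. C * indicator (cball 0 S) x"])
    show "(\<lambda>x. F' x i) \<in> borel_measurable lborel"
      using borel_measurable_continuous_onI[OF cont] by simp
    show "integrable lborel (\<lambda>x::'a. C * indicator (cball 0 S) x)"
      by (intro integrable_mult_right integrable_real_indicator) (auto intro: emeasure_bounded_finite[simplified])
  qed (use qlim qbd qmeas in auto)
  then have "integral\<^sup>L lborel (\<lambda>x. F' x i) = 0"
    by (simp add: q0 LIMSEQ_const_iff)
  \<comment> \<open>The limit argument took place in \<open>lborel\<close>; passing to the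
    completion does not change the integral of a Borel function.\<close>
  then show ?thesis
    by (simp add: integral_completion borel_measurable_continuous_onI[OF cont])
qed

text \<open>Unfolding the coinductive \<open>smooth\<close> twice gives continuous
  differentiability: each partial derivative is again smooth, so it is differentiable and hence
  continuous. No higher regularity of test functions is drawn on later.\<close>

lemma test_fun_has_derivative:
  assumes "test_fun \<phi>"
  shows "(\<phi> has_derivative frechet_derivative \<phi> (at x)) (at x)"
    and "i \<in> Basis \<Longrightarrow> continuous_on UNIV (\<lambda>x. frechet_derivative \<phi> (at x) i)"
proof -
  have sm: "smooth \<phi>"
    using assms by (simp add: test_fun_def)
  then show "(\<phi> has_derivative frechet_derivative \<phi> (at x)) (at x)"
    by (cases rule: smooth.cases) (simp add: frechet_derivative_works)
  assume "i \<in> Basis"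
  then have "smooth (\<lambda>x. frechet_derivative \<phi> (at x) i)"
    by - (rule smooth.cases[OF sm], simp)
  then have "\<forall>x. (\<lambda>x. frechet_derivative \<phi> (at x) i) differentiable (at x)"
    by (cases rule: smooth.cases) simp
  then show "continuous_on UNIV (\<lambda>x. frechet_derivative \<phi> (at x) i)"
    by (simp add: differentiable_imp_continuous_within continuous_at_imp_continuous_on)
qed

text \<open>The classical partial derivatives serve as weak ones. The product
  \<open>f * \<phi>\<close> inherits its bounded support from \<open>f\<close>, so the integral of
  its directional derivative is zero, and the product rule splits that integral into the two
  required terms.\<close>

lemma C1_bounded_support_W1p:
  fixes f :: "'a::euclidean_space \<Rightarrow> real"
  assumes der: "\<And>x. (f has_derivative f' x) (at x)"
    and cont: "\<And>i. i \<in> Basis \<Longrightarrow> continuous_on UNIV (\<lambda>x. f' x i)"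
    and supp: "\<And>x. x \<notin> cball 0 R \<Longrightarrow> f x = 0" and p: "0 < p"
  shows "f \<in> W1p p"
proof -
  have contf: "continuous_on UNIV f"
    using der has_derivative_continuous_on[of UNIV f f'] by simp
  have supp': "f' x i = 0" if "x \<notin> cball 0 R" for x i
    by (rule has_derivative_zero_outside_support[OF der supp that])
  have parts: "integral\<^sup>L lebesgue (\<lambda>x. f x * frechet_derivative \<phi> (at x) i)
        = - integral\<^sup>L lebesgue (\<lambda>x. f' x i * \<phi> x)" if i: "i \<in> Basis" and \<phi>: "test_fun \<phi>" for i \<phi>
  proof -
    note d\<phi> = test_fun_has_derivative[OF \<phi>]
    have cont\<phi>: "continuous_on UNIV \<phi>"
      using d\<phi>(1) by (intro continuous_at_imp_continuous_on ballI has_derivative_continuous)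
    have c: "continuous_on UNIV (\<lambda>x. f x * frechet_derivative \<phi> (at x) i)"
        "continuous_on UNIV (\<lambda>x. f' x i * \<phi> x)"
      by (intro continuous_intros contf cont\<phi> cont i d\<phi>(2))+
    have "integral\<^sup>L lebesgue (\<lambda>x. f x * frechet_derivative \<phi> (at x) i + f' x i * \<phi> x) = 0"
      by (rule integral_directional_derivative_zero
            [of "\<lambda>x. f x * \<phi> x" "\<lambda>x h. f x * frechet_derivative \<phi> (at x) h + f' x h * \<phi> x" i R])
         (auto intro!: has_derivative_mult der d\<phi>(1) continuous_on_add c simp: supp)
    moreover have "integrable lebesgue (\<lambda>x. f x * frechet_derivative \<phi> (at x) i)"
      by (rule integrable_continuous_bounded_support(2)[OF c(1), of R]) (simp add: supp)
    moreover have "integrable lebesgue (\<lambda>x. f' x i * \<phi> x)"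
      by (rule integrable_continuous_bounded_support(2)[OF c(2), of R]) (simp add: supp')
    ultimately show ?thesis by simp
  qed
  have "f \<in> Lp p"
    by (rule Lp_continuous_bounded_support[OF contf supp p])
  moreover have "(\<lambda>x. f' x i) \<in> Lp p" if "i \<in> Basis" for i
    by (rule Lp_continuous_bounded_support[OF cont[OF that] supp' p])
  ultimately show ?thesis
    using parts unfolding W1p_def by (auto intro!: bexI[of _ "\<lambda>x. f' x _"])
qed

section \<open>A growth criterion for not belonging to \<open>Lp p\<close>\<close>

lemma not_Lp_if_slowly_decaying:
  fixes f :: "'a::euclidean_space \<Rightarrow> real"
  assumes low: "\<And>R x. 0 < R \<Longrightarrow> norm x \<le> R \<Longrightarrow> m R \<le> \<bar>f x\<bar> powr p"
    and lim: "filterlim (\<lambda>R. R * m R) at_top at_top" and m: "\<And>R. 0 < R \<Longrightarrow> 0 \<le> m R"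
  shows "f \<notin> Lp p"
proof
  assume "f \<in> Lp p"
  then have int: "integrable lebesgue (\<lambda>x. \<bar>f x\<bar> powr p)"
    by (simp add: Lp_def)
  let ?I = "integral\<^sup>L lebesgue (\<lambda>x. \<bar>f x\<bar> powr p)"
  let ?v = "unit_ball_vol (real DIM('a))"
  have v: "0 < ?v" by simp
  have bound: "R * m R \<le> ?I / ?v" if R: "1 \<le> R" for R
  proof -
    \<comment> \<open>Integrating the lower bound \<open>m R\<close> over the ball of radius
      \<open>R\<close> gives at least \<open>?v * R ^ DIM('a) * m R\<close>. As the dimension is at
      least 1, the power may be lowered to \<open>R\<close> when \<open>R\<close> is at least 1, so
      one hypothesis covers all dimensions.\<close>
    have "R * m R \<le> R ^ DIM('a) * m R"
      using R m[of R] self_le_power[of R "DIM('a)"] by (intro mult_right_mono) auto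
    moreover have "measure lebesgue (cball (0::'a) R) * m R = integral\<^sup>L lebesgue (\<lambda>x::'a. indicator (cball 0 R) x * m R)"
      by simp
    moreover have "\<dots> \<le> ?I"
    proof (rule integral_mono[OF _ int])
      show "integrable lebesgue (\<lambda>x::'a. indicator (cball 0 R) x * m R)"
        by (intro integrable_mult_left integrable_real_indicator) (auto intro: emeasure_bounded_finite[simplified])
      show "indicator (cball 0 R) x * m R \<le> \<bar>f x\<bar> powr p" for x
        using low[of R x] R by (auto simp: indicator_def)
    qed
    ultimately have "?v * (R * m R) \<le> ?I"
      using R v content_cball[of R "0::'a"] by (simp add: mult.assoc order_trans[OF mult_left_mono])
    then show ?thesis
      using v by (simp add: field_simps)
  qed
  have "eventually (\<lambda>R. ?I / ?v + 1 \<le> R * m R) at_top"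
    using lim by (simp add: filterlim_at_top)
  moreover have "eventually (\<lambda>R::real. 1 \<le> R) at_top"
    by (rule eventually_ge_at_top)
  ultimately have "eventually (\<lambda>R::real. False) at_top"
    by eventually_elim (use bound in force)
  then show False by simp
qed

section \<open>Truncating the function 1/s of one real variable\<close>

lemma has_real_derivative_max_0_square:
  "((\<lambda>y::real. (max 0 y)\<^sup>2) has_real_derivative 2 * max 0 y) (at y)"
proof -
  consider "y < 0" | "y = 0" | "y > 0" by linarith
  then show ?thesis
  proof cases
    case 1
    have "((\<lambda>y::real. 0) has_real_derivative 0) (at y)" by simp
    then have "((\<lambda>y::real. (max 0 y)\<^sup>2) has_real_derivative 0) (at y)"
      by (rule has_field_derivative_transform_within_open[of _ _ _ "{..<0}"]) (use 1 in auto)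
    then show ?thesis using 1 by simp
  next
    case 2
    \<comment> \<open>Away from 0 the difference quotient of the squared positive part at 0 is
      \<open>max 0 y\<close> itself.\<close>
    have "((\<lambda>y::real. max 0 y) \<longlongrightarrow> max 0 0) (at 0)"
      by (intro tendsto_intros)
    then have "((\<lambda>y::real. ((max 0 y)\<^sup>2 - (max 0 0)\<^sup>2) / (y - 0)) \<longlongrightarrow> 0) (at 0)"
      by (rule Lim_transform_eventually[OF tendsto_eq_rhs])
         (auto simp: eventually_at_filter max_def power2_eq_square)
    then show ?thesis
      using 2 by (simp add: has_field_derivative_iff)
  next
    case 3
    have "((\<lambda>y::real. y\<^sup>2) has_real_derivative 2 * y) (at y)"
      by (auto intro!: derivative_eq_intros)
    then have "((\<lambda>y::real. (max 0 y)\<^sup>2) has_real_derivative 2 * y) (at y)"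
      by (rule has_field_derivative_transform_within_open[of _ _ _ "{0<..}"]) (use 3 in auto)
    then show ?thesis using 3 by simp
  qed
qed

text \<open>The error \<open>D\<close> is affine with slope \<open>e^2\<close> up to s = 1/e and
  equals -1/s beyond. The two pieces meet at 1/e with the same value and slope, and -1/s has slope
  at most \<open>e^2\<close> from there on. The Lipschitz bound is checked algebraically, according
  to the sides of 1/e on which the two points lie.\<close>

lemma truncation_error_bounds:
  fixes e s t :: real
  defines "D \<equiv> \<lambda>s. (max 0 (1 - e * s))\<^sup>2 / s - 1 / s"
  assumes e: "0 < e" and s: "0 < s" and t: "0 < t"
  shows "\<bar>D s\<bar> \<le> 2 * e" and "\<bar>D s - D t\<bar> \<le> e\<^sup>2 * \<bar>s - t\<bar>"
proof -
  have small: "D s = e\<^sup>2 * s - 2 * e" if "0 < s" "e * s \<le> 1" for s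
    using that by (simp add: D_def field_simps power2_eq_square)
  have large: "D s = - 1 / s" "1 / s \<le> e" if "0 < s" "1 < e * s" for s
    using that by (simp_all add: D_def field_simps)
  have le: "e\<^sup>2 * s \<le> e" if "e * s \<le> 1" for s
    using mult_left_mono[OF that, of e] e by (simp add: power2_eq_square)
  have pos: "0 < e\<^sup>2 * s" using e s by simp
  show "\<bar>D s\<bar> \<le> 2 * e"
  proof (cases "e * s \<le> 1")
    case True
    then show ?thesis using small[OF s] le[of s] pos e by auto
  next
    case False
    then have "D s = - (1 / s)" "1 / s \<le> e" "0 < 1 / s" using large[of s] s by auto
    then show ?thesis using e by linarith
  qed
  have mixed: "\<bar>D s - D t\<bar> \<le> e\<^sup>2 * (t - s)" if "0 < s" "0 < t" "e * s \<le> 1" "1 < e * t" for s t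
  proof -
    have "0 \<le> (1 - e * t)\<^sup>2 / t" using that by simp
    also have "\<dots> = 1 / t - 2 * e + e\<^sup>2 * t"
      using that by (simp add: field_simps power2_eq_square)
    finally have *: "0 \<le> 1 / t - 2 * e + e\<^sup>2 * t" .
    have "D s = e\<^sup>2 * s - 2 * e" "D t = - (1 / t)" "1 / t \<le> e" "e\<^sup>2 * s \<le> e"
      using small[of s] large[of t] le[of s] that by auto
    then show ?thesis
      using * by (simp add: algebra_simps abs_le_iff)
  qed
  show "\<bar>D s - D t\<bar> \<le> e\<^sup>2 * \<bar>s - t\<bar>"
  proof (cases "e * s \<le> 1"; cases "e * t \<le> 1")
    assume "e * s \<le> 1" "e * t \<le> 1"
    then have "D s - D t = e\<^sup>2 * (s - t)"
      using small[OF s] small[OF t] by (simp add: right_diff_distrib)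
    then show ?thesis by (simp add: abs_mult)
  next
    assume "e * s \<le> 1" "\<not> e * t \<le> 1"
    then have "\<bar>D s - D t\<bar> \<le> e\<^sup>2 * (t - s)" using mixed s t by simp
    also have "\<dots> \<le> e\<^sup>2 * \<bar>s - t\<bar>" by (intro mult_left_mono) auto
    finally show ?thesis .
  next
    assume "\<not> e * s \<le> 1" "e * t \<le> 1"
    then have "\<bar>D t - D s\<bar> \<le> e\<^sup>2 * (s - t)" using mixed s t by simp
    also have "\<dots> \<le> e\<^sup>2 * \<bar>s - t\<bar>" by (intro mult_left_mono) auto
    finally show ?thesis by (simp add: abs_minus_commute)
  next
    assume *: "\<not> e * s \<le> 1" "\<not> e * t \<le> 1"
    then have "D s - D t = (1 / s) * (1 / t) * (s - t)"
      using large(1)[of s] large(1)[of t] s t by (simp add: diff_divide_distrib right_diff_distrib)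
    then have "\<bar>D s - D t\<bar> = (1 / s) * (1 / t) * \<bar>s - t\<bar>"
      using s t by (simp add: abs_mult)
    also have "\<dots> \<le> e * e * \<bar>s - t\<bar>"
      using large[of s] large[of t] s t e * by (intro mult_right_mono mult_mono) auto
    finally show ?thesis by (simp add: power2_eq_square)
  qed
qed

section \<open>The logarithmic weight and its truncated reciprocal\<close>

definition log_weight :: "'a::euclidean_space \<Rightarrow> real" where
  "log_weight x = 1 + ln (1 + x \<bullet> x)"

lemma log_weight_ge_1: "1 \<le> log_weight x"
  by (simp add: log_weight_def)

text \<open>Using \<open>x \<bullet> x\<close> instead of the norm makes the weight differentiable
  at the origin as well.\<close>

lemma log_weight_has_derivative:
  "(log_weight has_derivative (\<lambda>h. 2 * (x \<bullet> h) / (1 + x \<bullet> x))) (at x)"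
proof -
  have "0 < 1 + x \<bullet> x"
    using inner_ge_zero[of x] by linarith
  then show ?thesis
    unfolding log_weight_def
    by (auto intro!: derivative_eq_intros simp: inner_commute field_simps)
qed

lemma log_weight_lipschitz: "1-lipschitz_on UNIV (log_weight :: 'a::euclidean_space \<Rightarrow> real)"
proof (rule lipschitz_onI)
  fix x y :: 'a
  have bd: "onorm (\<lambda>h. 2 * (z \<bullet> h) / (1 + z \<bullet> z)) \<le> 1" for z :: 'a
  proof (rule onorm_le)
    fix h
    have "2 * \<bar>z \<bullet> h\<bar> \<le> 2 * norm z * norm h"
      using Cauchy_Schwarz_ineq2[of z h] by simp
    \<comment> \<open>Expanding (|z| - 1)^2 >= 0 gives 2|z| <= 1 + |z|^2, which is why the Lipschitz
      constant is 1.\<close>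
    also have "\<dots> \<le> (1 + (norm z)\<^sup>2) * norm h"
      using zero_le_power2[of "norm z - 1"]
      by (intro mult_right_mono) (auto simp: power2_eq_square algebra_simps)
    finally have "2 * \<bar>z \<bullet> h\<bar> \<le> norm h * (1 + z \<bullet> z)"
      by (simp add: power2_norm_eq_inner mult.commute)
    moreover have "0 < 1 + z \<bullet> z"
      using inner_ge_zero[of z] by linarith
    ultimately show "norm (2 * (z \<bullet> h) / (1 + z \<bullet> z)) \<le> 1 * norm h"
      by (simp add: abs_mult pos_divide_le_eq)
  qed
  show "dist (log_weight x) (log_weight y) \<le> 1 * dist x y"
    unfolding dist_norm
    by (rule differentiable_bound[OF convex_UNIV log_weight_has_derivative bd]) auto
qed simp

lemma log_weight_mono: "norm x \<le> R \<Longrightarrow> log_weight x \<le> 1 + ln (1 + R\<^sup>2)"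
  unfolding log_weight_def power2_norm_eq_inner[symmetric]
  by (simp add: power_mono add_pos_nonneg)

text \<open>The two error estimates are the one-variable bounds evaluated at the weight, which is
  1-Lipschitz. The squared positive part is what makes the truncation continuously differentiable
  where it reaches 0, so the criterion for \<open>W1p\<close> applies.\<close>

lemma truncated_inverse_log_weight:
  fixes e p :: real
  assumes e: "0 < e" and p: "0 < p"
  defines "f \<equiv> \<lambda>x::'a::euclidean_space. (max 0 (1 - e * log_weight x))\<^sup>2 / log_weight x"
  shows "f \<in> W1p p"
    and "\<bar>f x - 1 / log_weight x\<bar> \<le> 2 * e"
    and "(e\<^sup>2)-lipschitz_on UNIV (\<lambda>x. f x - 1 / log_weight x)"
proof -
  have pos: "0 < log_weight x" for x :: 'a
    using log_weight_ge_1[of x] by linarith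
  note D = truncation_error_bounds[OF e pos pos]
  show "\<bar>f x - 1 / log_weight x\<bar> \<le> 2 * e"
    unfolding f_def by (rule D(1))
  show "(e\<^sup>2)-lipschitz_on UNIV (\<lambda>x. f x - 1 / log_weight x)"
  proof (rule lipschitz_onI)
    fix x y :: 'a
    have "\<bar>(f x - 1 / log_weight x) - (f y - 1 / log_weight y)\<bar> \<le> e\<^sup>2 * \<bar>log_weight x - log_weight y\<bar>"
      unfolding f_def by (rule D(2))
    also have "\<dots> \<le> e\<^sup>2 * dist x y"
      using lipschitz_onD[OF log_weight_lipschitz, of x y]
      by (intro mult_left_mono) (auto simp: dist_real_def)
    finally show "dist (f x - 1 / log_weight x) (f y - 1 / log_weight y) \<le> e\<^sup>2 * dist x y"
      by (simp add: dist_real_def)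
  qed simp
  \<comment> \<open>This is the quotient rule applied to the truncated reciprocal; it is continuous
    for s > 0 because \<open>max\<close> is.\<close>
  define \<psi> where "\<psi> s = (2 * max 0 (1 - e * s) * (- e) * s - (max 0 (1 - e * s))\<^sup>2) / s\<^sup>2" for s
  have d\<psi>: "((\<lambda>s. (max 0 (1 - e * s))\<^sup>2 / s) has_real_derivative \<psi> s) (at s)" if "0 < s" for s
  proof -
    have "((\<lambda>s. 1 - e * s) has_real_derivative (- e)) (at s)"
      by (auto intro!: derivative_eq_intros)
    from DERIV_chain2[OF has_real_derivative_max_0_square this]
    have "((\<lambda>s. (max 0 (1 - e * s))\<^sup>2) has_real_derivative (2 * max 0 (1 - e * s) * (- e))) (at s)" .
    from DERIV_divide[OF this DERIV_ident] that show ?thesis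
      by (simp add: \<psi>_def power2_eq_square)
  qed
  show "f \<in> W1p p"
  \<comment> \<open>If |x| > exp (1/e), then |x| >= 1 and |x|^2 >= |x|, so the logarithm in the
    weight is at least 1/e and the positive part vanishes.\<close>
  proof (rule C1_bounded_support_W1p[where R="exp (1 / e)"])
    show "(f has_derivative (\<lambda>h. \<psi> (log_weight x) * (2 * (x \<bullet> h) / (1 + x \<bullet> x)))) (at x)" for x
      unfolding f_def
      using has_derivative_compose[OF log_weight_has_derivative
          d\<psi>[OF pos, unfolded has_field_derivative_def], of x]
      by simp
    have cw: "continuous_on UNIV (log_weight :: 'a \<Rightarrow> real)"
      by (rule lipschitz_on_continuous_on[OF log_weight_lipschitz])
    have "1 + x \<bullet> x \<noteq> 0" "log_weight x \<noteq> 0" for x :: 'a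
      using inner_ge_zero[of x] pos[of x] by linarith+
    then show "continuous_on UNIV (\<lambda>x. \<psi> (log_weight x) * (2 * (x \<bullet> i) / (1 + x \<bullet> x)))" for i :: 'a
      unfolding \<psi>_def by (intro continuous_intros cw) auto
    show "f x = 0" if "x \<notin> cball 0 (exp (1 / e))" for x
    proof -
      have n: "exp (1 / e) < norm x" using that by simp
      have "1 < exp (1 / e)" using e by simp
      with n have "1 \<le> norm x" by linarith
      then have "norm x * 1 \<le> norm x * norm x" by (intro mult_left_mono) auto
      with n have "exp (1 / e) \<le> 1 + x \<bullet> x"
        by (simp add: power2_norm_eq_inner[symmetric] power2_eq_square)
      then have "1 / e \<le> ln (1 + x \<bullet> x)"
        by (simp add: ln_ge_iff add_pos_nonneg)
      then have "1 / e \<le> log_weight x" by (simp add: log_weight_def)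
      then show ?thesis using e by (simp add: f_def field_simps)
    qed
  qed (rule p)
qed

section \<open>The two functions witnessing strictness of the inclusions\<close>

lemma inverse_log_weight_Lambda1:
  shows "(\<lambda>x::'a::euclidean_space. 1 / log_weight x) \<in> Lambda1"
proof (rule lipschitz_bounded_Lambda1(1))
  show "\<bar>1 / log_weight x\<bar> \<le> 1" for x :: 'a
    using log_weight_ge_1[of x] by simp
  show "1-lipschitz_on UNIV (\<lambda>x::'a. 1 / log_weight x)"
  proof (rule lipschitz_onI)
    fix x y :: 'a
    let ?s = "log_weight x" and ?t = "log_weight y"
    have st: "1 \<le> ?s" "1 \<le> ?t" by (rule log_weight_ge_1)+
    then have "1 / ?s - 1 / ?t = (?t - ?s) / (?s * ?t)"
      by (simp add: field_simps)
    then have "\<bar>1 / ?s - 1 / ?t\<bar> = \<bar>?t - ?s\<bar> / (?s * ?t)"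
      using st by (simp add: abs_mult)
    also have "\<dots> \<le> \<bar>?t - ?s\<bar> / 1"
      using st mult_mono[of 1 ?s 1 ?t] by (intro divide_left_mono) auto
    also have "\<dots> \<le> dist x y"
      using lipschitz_onD[OF log_weight_lipschitz, of y x] by (simp add: dist_real_def dist_commute)
    finally show "dist (1 / ?s) (1 / ?t) \<le> 1 * dist x y"
      by (simp add: dist_real_def)
  qed simp
qed

lemma inverse_log_weight_not_Lp:
  assumes p: "0 < p"
  shows "(\<lambda>x::'a::euclidean_space. 1 / log_weight x) \<notin> Lp p"
proof (rule not_Lp_if_slowly_decaying)
  fix R :: real and x :: 'a
  assume "0 < R" "norm x \<le> R"
  then have "1 / (1 + ln (1 + R\<^sup>2)) \<le> 1 / log_weight x"
    using log_weight_mono[of x R] log_weight_ge_1[of x] by (intro divide_left_mono) auto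
  moreover have "0 \<le> 1 / (1 + ln (1 + R\<^sup>2))" by simp
  ultimately show "(1 / (1 + ln (1 + R\<^sup>2))) powr p \<le> \<bar>1 / log_weight x\<bar> powr p"
    using p log_weight_ge_1[of x] by (intro powr_mono2) auto
next
  \<comment> \<open>Any power of a logarithm grows more slowly than \<open>R\<close>, whatever the
    exponent \<open>p\<close>.\<close>
  show "filterlim (\<lambda>R. R * (1 / (1 + ln (1 + R\<^sup>2))) powr p) at_top at_top"
    using p by real_asymp
qed simp

lemma inverse_log_weight_in_closure:
  assumes p: "0 < p"
  shows "(\<lambda>x::'a::euclidean_space. 1 / log_weight x) \<in> Lambda1_closure (W1p p \<inter> Lambda1)"
proof -
  let ?g = "\<lambda>x::'a. 1 / log_weight x"
  have "\<exists>f\<in>W1p p \<inter> Lambda1. Lambda1_norm (\<lambda>x. f x - ?g x) < \<epsilon>" if \<epsilon>: "0 < \<epsilon>" for \<epsilon>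
  proof -
    \<comment> \<open>The norm of the error is at most 2e + 2e^2. With e <= 1 this is at most 4e,
      which is strictly below 5e and so below the tolerance.\<close>
    define e where "e = min 1 (\<epsilon> / 5)"
    have e: "0 < e" "e \<le> 1" "5 * e \<le> \<epsilon>" using \<epsilon> by (auto simp: e_def)
    let ?f = "\<lambda>x::'a. (max 0 (1 - e * log_weight x))\<^sup>2 / log_weight x"
    let ?d = "\<lambda>x. ?f x - ?g x"
    \<comment> \<open>The negated error is needed to recover \<open>?f\<close> as the difference
      \<open>?g - (0 - ?d)\<close> of two members of \<open>Lambda1\<close>.\<close>
    have neg: "(\<lambda>x. 0 - ?d x) \<in> Lambda1" and nrm: "Lambda1_norm ?d \<le> 2 * e + 2 * e\<^sup>2"
    proof -
      note d = lipschitz_bounded_Lambda1[OF truncated_inverse_log_weight(2,3)[OF e(1) p]]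
      show "Lambda1_norm ?d \<le> 2 * e + 2 * e\<^sup>2" by (rule d(2))
      have "(\<lambda>x::'a. 0) \<in> Lambda1"
        by (rule lipschitz_bounded_Lambda1(1)[of _ 0 0]) (auto simp: lipschitz_on_def)
      then show "(\<lambda>x. 0 - ?d x) \<in> Lambda1" by (rule diff_Lambda1[OF _ d(1)])
    qed
    have "?f \<in> Lambda1"
      using diff_Lambda1[OF inverse_log_weight_Lambda1 neg] by simp
    moreover have "?f \<in> W1p p"
      by (rule truncated_inverse_log_weight(1)[OF e(1) p])
    moreover have "e\<^sup>2 \<le> e"
      using e mult_left_mono[of e 1 e] by (simp add: power2_eq_square)
    then have "Lambda1_norm ?d < \<epsilon>"
      using nrm e by linarith
    ultimately show ?thesis by (intro bexI[of _ ?f]) simp_all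
  qed
  then show ?thesis
    using inverse_log_weight_Lambda1 by (simp add: Lambda1_closure_def)
qed

lemma one_Lambda1: "(\<lambda>x::'a::euclidean_space. 1) \<in> Lambda1"
  by (rule lipschitz_bounded_Lambda1(1)[of _ 1 0]) (auto simp: lipschitz_on_def)

text \<open>An approximant within 1/2 of the constant 1 has absolute value at least 1/2 everywhere,
  so the growth criterion applies with a constant lower bound.\<close>

lemma one_not_in_closure:
  assumes p: "0 < p"
  shows "(\<lambda>x::'a::euclidean_space. 1) \<notin> Lambda1_closure (W1p p \<inter> Lambda1)"
proof
  assume "(\<lambda>x::'a. 1) \<in> Lambda1_closure (W1p p \<inter> Lambda1)"
  then obtain f :: "'a \<Rightarrow> real" where f: "f \<in> W1p p" "f \<in> Lambda1"
    and n: "Lambda1_norm (\<lambda>x. f x - 1) < 1 / 2"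
    unfolding Lambda1_closure_def by (auto dest!: spec[of _ "1 / 2"])
  have half: "1 / 2 \<le> \<bar>f x\<bar>" for x
    using abs_le_Lambda1_norm[OF diff_Lambda1[OF f(2) one_Lambda1], of x] n by linarith
  have "f \<notin> Lp p"
  proof (rule not_Lp_if_slowly_decaying)
    show "(1 / 2) powr p \<le> \<bar>f x\<bar> powr p" for x
      using half[of x] p by (intro powr_mono2) auto
    show "filterlim (\<lambda>R::real. R * (1 / 2) powr p) at_top at_top"
      by real_asymp
  qed simp
  then show False
    using f(1) by (simp add: W1p_def)
qed

theorem mainTheorem14:
  fixes p :: real
  assumes "1 < p"
  shows "(W1p p \<inter> Lambda1 :: ('a::euclidean_space \<Rightarrow> real) set)
            \<subset> Lambda1_closure (W1p p \<inter> Lambda1)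
         \<and> Lambda1_closure (W1p p \<inter> Lambda1) \<subset> (Lambda1 :: ('a \<Rightarrow> real) set)"
proof -
  have p: "0 < p" using assms by simp
  have "W1p p \<inter> Lambda1 \<subseteq> (Lambda1_closure (W1p p \<inter> Lambda1) :: ('a \<Rightarrow> real) set)"
    by (rule subset_Lambda1_closure) simp
  moreover have "(\<lambda>x::'a. 1 / log_weight x) \<notin> W1p p"
    using inverse_log_weight_not_Lp[OF p] by (auto simp: W1p_def)
  moreover have "Lambda1_closure (W1p p \<inter> Lambda1) \<subseteq> (Lambda1 :: ('a \<Rightarrow> real) set)"
    by (auto simp: Lambda1_closure_def)
  ultimately show ?thesis
    using inverse_log_weight_in_closure[OF p] one_Lambda1 one_not_in_closure[OF p] by blast
qed

end
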